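(* Every maximum affine equiangular set in $L$ with norm $3$ with respect to the switching root $\rho$ is not strongly maximal.
   Context: Lattices. $A_n=\{x\in\mathbb{Z}^{n+1}: x_1+\cdots+x_{n+1}=0\}$ and $\alpha_n=(\frac1{n+1},\dots,\frac1{n+1},-\frac n{n+1})\in\mathbb{R}^{n+1}$ (so $\alpha_1=(\frac12,-\frac12)$). Let $\Lambda=A_5^3\oplus A_1^4\subset\mathbb{R}^{26}$; vectors of $\mathbb{R}^{26}$ are written $(v_1,\dots,v_7)$ with $v_1,v_2,v_3\in\mathbb{R}^6$ and $v_4,\dots,v_7\in\mathbb{R}^2$. Let $\beta_0=(\alpha_5,\alpha_5,\alpha_5,0,0,0,\alpha_1)$, $\beta_1=(3\alpha_5,0,0,0,\alpha_1,\alpha_1,\alpha_1)$, $\beta_2=(0,3\alpha_5,0,\alpha_1,0,\alpha_1,\alpha_1)$, $\beta_3=(0,0,3\alpha_5,\alpha_1,\alpha_1,0,\alpha_1)$. $L$ is the lattice generated by $\Lambda$ and $\beta_0,\beta_1,\beta_2,\beta_3$ (an integral lattice). Let $\rho=(0,0,0,0,0,0,2\alpha_1)$. Affine equiangular sets. A set $\omega$ of vectors in a Euclidean space containing $\rho$ is an affine equiangular set with norm $3$ with respect to the switching root $\rho$ if $(u,\rho)=1$ and $(u,u)=3$ for all $u\in\omega$, and $(u,v)\in\{0,1\}$ for all distinct $u,v\in\omega$, where $(\cdot,\cdot)$ is the inner product. It is in $L$ if $\omega\subset L$, and it is maximum in $L$ if no such set in $L$ has larger cardinality. An affine equiangular set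 $\omega$ with norm $3$ with respect to $\rho$ is strongly maximal if there is no affine equiangular set with norm $3$ with respect to $\rho$ properly containing $\omega$, even if the dimension of the underlying Euclidean space is increased (i.e. even when the ambient space is isometrically embedded in a Euclidean space of arbitrary larger finite dimension). *)

theory Defs
  imports
    Complex_Main
    "Jordan_Normal_Form.Matrix"
    "HOL-Algebra.Generated_Groups"
    "HOL-Library.Equipollence"
begin

text \<open>
  Euclidean \<open>n\<close>-space is modelled by \<open>carrier_vec n :: real vec set\<close> with the inner product
  \<open>scalar_prod\<close>, so that one can quantify over the dimension.
  Coordinates are numbered from \<open>0\<close>.
\<close>

definition A_lattice :: "nat \<Rightarrow> real vec set" where
  "A_lattice n = {x \<in> carrier_vec (n + 1). (\<forall>i<n + 1. x $ i \<in> \<int>) \<and> (\<Sum>i<n + 1. x $ i) = 0}"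

definition alpha :: "nat \<Rightarrow> real vec" where
  "alpha n = vec (n + 1) (\<lambda>i. if i < n then 1 / (real n + 1) else - real n / (real n + 1))"

definition blocks ::
  "real vec \<Rightarrow> real vec \<Rightarrow> real vec \<Rightarrow> real vec \<Rightarrow> real vec \<Rightarrow> real vec \<Rightarrow> real vec \<Rightarrow> real vec" where
  "blocks v1 v2 v3 v4 v5 v6 v7 =
     v1 @\<^sub>v v2 @\<^sub>v v3 @\<^sub>v v4 @\<^sub>v v5 @\<^sub>v v6 @\<^sub>v v7"

definition Lambda_lattice :: "real vec set" where
  "Lambda_lattice = {blocks v1 v2 v3 v4 v5 v6 v7 | v1 v2 v3 v4 v5 v6 v7.
     v1 \<in> A_lattice 5 \<and> v2 \<in> A_lattice 5 \<and> v3 \<in> A_lattice 5 \<and>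
     v4 \<in> A_lattice 1 \<and> v5 \<in> A_lattice 1 \<and> v6 \<in> A_lattice 1 \<and> v7 \<in> A_lattice 1}"

definition beta0 :: "real vec" where
  "beta0 = blocks (alpha 5) (alpha 5) (alpha 5) (0\<^sub>v 2) (0\<^sub>v 2) (0\<^sub>v 2) (alpha 1)"

definition beta1 :: "real vec" where
  "beta1 = blocks (3 \<cdot>\<^sub>v alpha 5) (0\<^sub>v 6) (0\<^sub>v 6) (0\<^sub>v 2) (alpha 1) (alpha 1) (alpha 1)"

definition beta2 :: "real vec" where
  "beta2 = blocks (0\<^sub>v 6) (3 \<cdot>\<^sub>v alpha 5) (0\<^sub>v 6) (alpha 1) (0\<^sub>v 2) (alpha 1) (alpha 1)"

definition beta3 :: "real vec" where
  "beta3 = blocks (0\<^sub>v 6) (0\<^sub>v 6) (3 \<cdot>\<^sub>v alpha 5) (alpha 1) (alpha 1) (0\<^sub>v 2) (alpha 1)"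

text \<open>The operation of \<open>monoid_vec\<close> is vector addition, so \<open>generate\<close> yields all integer combinations.\<close>

definition L_lattice :: "real vec set" where
  "L_lattice = generate (monoid_vec TYPE(real) 26) (Lambda_lattice \<union> {beta0, beta1, beta2, beta3})"

definition rho :: "real vec" where
  "rho = blocks (0\<^sub>v 6) (0\<^sub>v 6) (0\<^sub>v 6) (0\<^sub>v 2) (0\<^sub>v 2) (0\<^sub>v 2) (2 \<cdot>\<^sub>v alpha 1)"

text \<open>
  Affine equiangular sets of norm 3 in \<open>n\<close>-space with switching root \<open>r\<close>. The root is a vector of
  the space, not an element of the set. The set is not required to be finite.
\<close>

definition affine_equiangular :: "nat \<Rightarrow> real vec \<Rightarrow> real vec set \<Rightarrow> bool" where
  "affine_equiangular n r \<omega> \<longleftrightarrow>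
     r \<in> carrier_vec n \<and> \<omega> \<subseteq> carrier_vec n \<and>
     (\<forall>u\<in>\<omega>. u \<bullet> r = 1 \<and> u \<bullet> u = 3) \<and>
     (\<forall>u\<in>\<omega>. \<forall>v\<in>\<omega>. u \<noteq> v \<longrightarrow> u \<bullet> v \<in> {0, 1})"

text \<open>
  Cardinalities are compared by \<open>lesspoll\<close>, since \<open>card\<close> would give infinite sets cardinality zero.
\<close>

definition maximum_affine_equiangular_in ::
  "nat \<Rightarrow> real vec \<Rightarrow> real vec set \<Rightarrow> real vec set \<Rightarrow> bool" where
  "maximum_affine_equiangular_in n r M \<omega> \<longleftrightarrow>
     affine_equiangular n r \<omega> \<and> \<omega> \<subseteq> M \<and>
     \<not> (\<exists>\<omega>'. affine_equiangular n r \<omega>' \<and> \<omega>' \<subseteq> M \<and> lesspoll \<omega> \<omega>')"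

definition isometric_embedding :: "nat \<Rightarrow> nat \<Rightarrow> (real vec \<Rightarrow> real vec) \<Rightarrow> bool" where
  "isometric_embedding n m f \<longleftrightarrow>
     (\<forall>x\<in>carrier_vec n. f x \<in> carrier_vec m) \<and>
     (\<forall>x\<in>carrier_vec n. \<forall>y\<in>carrier_vec n. f (x + y) = f x + f y) \<and>
     (\<forall>c. \<forall>x\<in>carrier_vec n. f (c \<cdot>\<^sub>v x) = c \<cdot>\<^sub>v f x) \<and>
     (\<forall>x\<in>carrier_vec n. \<forall>y\<in>carrier_vec n. f x \<bullet> f y = x \<bullet> y)"

text \<open>The case \<open>m = n\<close> with the identity embedding covers maximality in the original space.\<close>

definition strongly_maximal :: "nat \<Rightarrow> real vec \<Rightarrow> real vec set \<Rightarrow> bool" where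
  "strongly_maximal n r \<omega> \<longleftrightarrow>
     affine_equiangular n r \<omega> \<and>
     (\<forall>m\<ge>n. \<forall>f. isometric_embedding n m f \<longrightarrow>
        \<not> (\<exists>\<omega>'. affine_equiangular m (f r) \<omega>' \<and> f ` \<omega> \<subset> \<omega>'))"

end

theory Submission
  imports Defs
begin

text \<open>
  Subtracting \<open>rho / 2\<close> turns an affine equiangular set into a system of vectors with pairwise
  inner products \<open>\<plusminus>1/2\<close>. For a 3-subset \<open>S\<close> of the six coordinates of the first block, take the vector
  \<open>p\<close> with first block \<open>\<plusminus>1/2\<close> (positive on \<open>S\<close>), fourth block \<open>(1, 0)\<close> and last block \<open>alpha 1\<close>.
  A norm 3 vector \<open>u\<close> of \<open>L\<close> with \<open>u \<bullet> rho = 1\<close> satisfies \<open>u \<bullet> p \<in> {0, 1}\<close>, unless its first block is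
  plus or minus that of \<open>p\<close>; in this case \<open>u\<close> is supported on the first block and the last three, and it
  is determined by \<open>S\<close> and a few signs. If all ten splittings \<open>S\<close>, complement of \<open>S\<close>, were blocked by
  elements of an affine equiangular set, their signs would be a proper edge colouring of the complete
  graph on five vertices with four colours, which does not exist. Hence some \<open>p\<close> extends the set.
  It is not in \<open>L\<close>, because its fourth block does not have sum zero.
\<close>

section \<open>Edge colourings of complete graphs of odd order\<close>

text \<open>In a proper colouring every colour class is a matching, so on \<open>2 * n + 1\<close>
  vertices it has at most \<open>n\<close> edges. Thus \<open>2 * n\<close> colours cover at most
  \<open>2 * n * n\<close> edges, fewer than the \<open>n * (2 * n + 1)\<close> edges
  present.\<close>

lemma complete_graph_edge_colouring:
  fixes V :: "'a set" and f :: "'a set \<Rightarrow> 'c"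
  assumes "card V = 2 * n + 1" "n > 0" "finite C" "card C \<le> 2 * n"
    and f: "\<And>e. e \<subseteq> V \<Longrightarrow> card e = 2 \<Longrightarrow> f e \<in> C"
  obtains e e' where "e \<subseteq> V" "card e = 2" "e' \<subseteq> V" "card e' = 2" "e \<noteq> e'" "f e = f e'"
    "e \<inter> e' \<noteq> {}"
proof (rule ccontr)
  note witness = that
  assume "\<not> thesis"
  then have disj: "e \<inter> e' = {}"
    if "e \<subseteq> V" "card e = 2" "e' \<subseteq> V" "card e' = 2" "e \<noteq> e'" "f e = f e'" for e e'
    using witness[OF that] by blast
  define E where "E = {e. e \<subseteq> V \<and> card e = 2}"
  have V: "finite V"
    using assms(1) card.infinite by fastforce
  then have "finite E"
    by (simp add: E_def)
  have cardE: "card E = n * (2 * n + 1)"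
    using n_subsets[OF V, of 2] assms(1) by (simp add: E_def choose_two)
  have class_le: "card {e \<in> E. f e = c} \<le> n" for c
  proof -
    let ?F = "{e \<in> E. f e = c}"
    have "card (\<Union> ?F) = sum card ?F"
      by (rule card_Union_disjoint)
        (auto simp: E_def disjoint_def pairwise_def disjnt_def disj intro: card_ge_0_finite)
    also have "\<dots> = 2 * card ?F"
      by (simp add: E_def)
    finally have "2 * card ?F = card (\<Union> ?F)" ..
    also have "\<dots> \<le> card V"
      by (rule card_mono[OF V]) (auto simp: E_def)
    finally show ?thesis
      using assms(1) by simp
  qed
  have "card E = card (\<Union>c\<in>C. {e \<in> E. f e = c})"
    using f by (intro arg_cong[where f = card]) (auto simp: E_def)
  also have "\<dots> \<le> (\<Sum>c\<in>C. card {e \<in> E. f e = c})"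
    by (rule card_UN_le[OF \<open>finite C\<close>])
  also have "\<dots> \<le> card C * n"
    using sum_bounded_above[of C "\<lambda>c. card {e \<in> E. f e = c}" n] class_le by simp
  also have "\<dots> \<le> 2 * n * n"
    using assms(4) by simp
  finally show False
    using cardE \<open>n > 0\<close> by (simp add: algebra_simps)
qed

section \<open>Cosets of the root lattices\<close>

text \<open>For \<open>c = k / m\<close> with an integer \<open>k\<close> this is the coset of
  \<open>k\<close> times the glue vector \<open>alpha (m - 1)\<close> modulo the root lattice,
  because all entries of that vector are congruent to \<open>1 / m\<close> modulo 1. Using functions
  lets a block of a long vector be addressed by an index shift.\<close>

definition in_coset :: "nat \<Rightarrow> real \<Rightarrow> (nat \<Rightarrow> real) \<Rightarrow> bool" where
  "in_coset m c y \<longleftrightarrow> (\<forall>i<m. y i - c \<in> \<int>) \<and> (\<Sum>i<m. y i) = 0"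

lemma in_coset_zero: "in_coset m 0 (\<lambda>_. 0)"
  by (simp add: in_coset_def)

lemma in_coset_add:
  assumes "in_coset m c y" "in_coset m d z"
  shows "in_coset m (c + d) (\<lambda>i. y i + z i)"
proof -
  have "(y i + z i) - (c + d) \<in> \<int>" if "i < m" for i
    using Ints_add[of "y i - c" "z i - d"] assms that by (simp add: in_coset_def algebra_simps)
  then show ?thesis
    using assms by (simp add: in_coset_def sum.distrib)
qed

lemma in_coset_uminus:
  assumes "in_coset m c y"
  shows "in_coset m (- c) (\<lambda>i. - y i)"
proof -
  have "- y i - (- c) \<in> \<int>" if "i < m" for i
    using Ints_minus[of "y i - c"] assms that by (simp add: in_coset_def)
  then show ?thesis
    using assms by (simp add: in_coset_def sum_negf)
qed

lemma in_coset_cong: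
  assumes "in_coset m c y" "c = d" "\<And>i. i < m \<Longrightarrow> y i = z i"
  shows "in_coset m d z"
  using assms by (simp add: in_coset_def)

lemma in_coset_2:
  assumes "in_coset 2 c y"
  shows "y 1 = - y 0" "y 0 - c \<in> \<int>"
  using assms by (auto simp: in_coset_def numeral_2_eq_2)

text \<open>The bound is the minimal norm of the coset. Each entry is \<open>r / 6 + n\<close> with
  an integer \<open>n\<close>; summing \<open>n * (n + 1) \<ge> 0\<close> over the entries and using
  that they sum to zero gives it.\<close>

lemma in_coset_6_norm_ge:
  assumes "in_coset 6 (real_of_int c / 6) y"
  shows "real_of_int ((c mod 6) * (6 - c mod 6)) / 6 \<le> (\<Sum>i<6. y i ^ 2)"
proof -
  define r where "r = c mod 6"
  have int: "y i - real_of_int r / 6 \<in> \<int>" if "i < 6" for i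
  proof -
    have "c = r + 6 * (c div 6)"
      by (simp add: r_def)
    then have "real_of_int c / 6 = real_of_int r / 6 + real_of_int (c div 6)"
      by (metis (no_types, lifting) add_divide_distrib nonzero_mult_div_cancel_left of_int_add
          of_int_mult of_int_numeral zero_neq_numeral)
    then have "y i - real_of_int r / 6 = (y i - real_of_int c / 6) + real_of_int (c div 6)"
      by linarith
    moreover have "y i - real_of_int c / 6 \<in> \<int>"
      using assms that by (simp add: in_coset_def)
    ultimately show ?thesis
      by (metis Ints_add Ints_of_int)
  qed
  \<comment> \<open>This is \<open>n * (n + 1) \<ge> 0\<close> expanded, with
    \<open>n = y i - r / 6\<close>.\<close>
  have "0 \<le> y i ^ 2 + (1 - real_of_int r / 3) * y i + (real_of_int r ^ 2 / 36 - real_of_int r / 6)"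
    if "i < 6" for i
  proof -
    obtain n where n: "y i - real_of_int r / 6 = real_of_int n"
      using int[OF \<open>i < 6\<close>] by (auto elim: Ints_cases)
    have "0 \<le> n * (n + 1)"
      by (cases "n \<ge> 0") (auto intro: mult_nonpos_nonpos)
    then have "0 \<le> real_of_int n * (real_of_int n + 1)"
      by (metis of_int_0_le_iff of_int_1 of_int_add of_int_mult)
    then show ?thesis
      unfolding n[symmetric] by (simp add: field_simps power2_eq_square)
  qed
  then have "0 \<le> (\<Sum>i<6. y i ^ 2 + (1 - real_of_int r / 3) * y i
      + (real_of_int r ^ 2 / 36 - real_of_int r / 6))"
    by (intro sum_nonneg) auto
  also have "\<dots> = (\<Sum>i<6. y i ^ 2) + (1 - real_of_int r / 3) * (\<Sum>i<6. y i)
      + 6 * (real_of_int r ^ 2 / 36 - real_of_int r / 6)"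
    by (simp add: sum.distrib sum_distrib_left)
  also have "(\<Sum>i<6. y i) = 0"
    using assms by (simp add: in_coset_def)
  finally show ?thesis
    unfolding r_def[symmetric] by (simp add: algebra_simps power2_eq_square)
qed

text \<open>For a 3-subset \<open>S\<close> of the six coordinates this is a minimal vector, of norm
  3/2, of the coset of \<open>3 \<cdot>\<^sub>v alpha 5\<close>; complementing \<open>S\<close>
  negates it.\<close>

definition half_split :: "nat set \<Rightarrow> nat \<Rightarrow> real" where
  "half_split S i = of_bool (i \<in> S) - 1 / 2"

lemma sum_half_split_mult:
  assumes "S \<subseteq> {..<6}" "T \<subseteq> {..<6}" "card S = 3" "card T = 3"
  shows "(\<Sum>i<6. half_split S i * half_split T i) = real (card (S \<inter> T)) - 3 / 2"
proof -
  have ind: "(\<Sum>i<6. of_bool (i \<in> U) :: real) = real (card U)" if "U \<subseteq> {..<6}" for U :: "nat set"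
    using that by (simp add: of_bool_def sum.If_cases Int_absorb1)
  have "(\<Sum>i<6. half_split S i * half_split T i)
      = (\<Sum>i<6. of_bool (i \<in> S \<inter> T) - (of_bool (i \<in> S) + of_bool (i \<in> T)) / 2 + 1 / 4)"
    by (intro sum.cong) (auto simp: half_split_def field_simps)
  also have "\<dots> = real (card (S \<inter> T)) - (real (card S) + real (card T)) / 2 + 6 / 4"
    using assms ind[of S] ind[of T] ind[of "S \<inter> T"]
    by (simp add: sum.distrib sum_subtractf flip: sum_divide_distrib) (auto simp: Int_def)
  finally show ?thesis
    using assms by simp
qed

lemma sum_half_split_sq:
  assumes "S \<subseteq> {..<6}" "card S = 3"
  shows "(\<Sum>i<6. half_split S i * half_split S i) = 3 / 2"
  using sum_half_split_mult[OF assms(1,1,2,2)] assms by simp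

lemma half_split_cauchy_schwarz:
  assumes "S \<subseteq> {..<6}" "card S = 3" "s = (\<Sum>i<6. half_split S i * y i)"
  shows "s ^ 2 \<le> 3 / 2 * (\<Sum>i<6. y i ^ 2)"
proof -
  \<comment> \<open>Squared distance from \<open>y\<close> to its orthogonal projection on the line
    of \<open>half_split S\<close>; the factor 2/3 is the inverse of the norm 3/2.\<close>
  have "0 \<le> (\<Sum>i<6. (y i - 2 / 3 * s * half_split S i) ^ 2)"
    by (intro sum_nonneg) auto
  also have "\<dots> = (\<Sum>i<6. y i ^ 2 - 4 / 3 * s * (half_split S i * y i)
      + 4 / 9 * s ^ 2 * (half_split S i * half_split S i))"
    by (intro sum.cong) (auto simp: power2_eq_square algebra_simps)
  also have "\<dots> = (\<Sum>i<6. y i ^ 2) - 4 / 3 * s * s + 4 / 9 * s ^ 2 * (3 / 2)"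
    unfolding sum_half_split_sq[OF assms(1,2), symmetric] assms(3)
    by (simp only: sum.distrib sum_subtractf sum_distrib_left)
  finally show ?thesis
    by (simp add: power2_eq_square algebra_simps)
qed

text \<open>Since \<open>y\<close> has sum zero, the constant -1/2 drops out and the product is the
  sum of the three entries over \<open>S\<close>, each congruent to \<open>c\<close> modulo
  1.\<close>

lemma half_split_sum_coset:
  assumes "in_coset 6 c y" "S \<subseteq> {..<6}" "card S = 3"
  shows "(\<Sum>i<6. half_split S i * y i) - 3 * c \<in> \<int>"
proof -
  have "(\<Sum>i<6. half_split S i * y i) = (\<Sum>i<6. (if i \<in> S then y i else 0) - y i / 2)"
    by (intro sum.cong) (auto simp: half_split_def algebra_simps)
  also have "\<dots> = (\<Sum>i<6. if i \<in> S then y i else 0)"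
    using assms(1) by (simp add: sum_subtractf in_coset_def flip: sum_divide_distrib)
  also have "\<dots> = (\<Sum>i\<in>S. y i)"
    using assms(2) by (simp add: sum.If_cases Int_absorb1)
  finally have "(\<Sum>i<6. half_split S i * y i) - 3 * c = (\<Sum>i\<in>S. y i - c)"
    using assms(3) by (simp add: sum_subtractf)
  also have "\<dots> \<in> \<int>"
    using assms(1,2) by (intro Ints_sum) (auto simp: in_coset_def)
  finally show ?thesis .
qed

section \<open>Norm 3 vectors of the lattice\<close>

lemma half_integer_square_ge:
  fixes t :: real
  assumes "t - real_of_int k / 2 \<in> \<int>" "odd k"
  shows "1 / 4 \<le> t ^ 2"
proof -
  obtain n where "t - real_of_int k / 2 = real_of_int n"
    using assms(1) by (auto elim: Ints_cases)
  then have t: "2 * t = real_of_int (2 * n + k)"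
    by simp
  have "2 * n + k \<noteq> 0"
    using assms(2) by presburger
  then have "1 \<le> \<bar>2 * n + k\<bar>"
    by simp
  then have "1 \<le> \<bar>2 * t\<bar>"
    unfolding t by linarith
  then have "1 \<le> (2 * t) ^ 2"
    by (metis abs_le_square_iff abs_one power_one)
  then show ?thesis
    by (simp add: power_mult_distrib)
qed

text \<open>The analysis of vectors whose product with the extending vector is at least 2. The last
  block contributes 1/2 to the norm 3 and 1/2 to the product, which leaves 5/2 and at least 3/2.
  Minimal norms of the cosets and Cauchy-Schwarz on the first block then leave no slack, so all
  bounds are attained.\<close>

lemma glue_norm_large_product:
  fixes y1 y2 y3 :: "nat \<Rightarrow> real" and a b1 b2 b3 :: int and t4 t5 t6 :: real
  assumes y1: "in_coset 6 (real_of_int (a + 3 * b1) / 6) y1"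
    and y2: "in_coset 6 (real_of_int (a + 3 * b2) / 6) y2"
    and y3: "in_coset 6 (real_of_int (a + 3 * b3) / 6) y3"
    and t4: "t4 - real_of_int (b2 + b3) / 2 \<in> \<int>"
    and t5: "t5 - real_of_int (b1 + b3) / 2 \<in> \<int>"
    and t6: "t6 - real_of_int (b1 + b2) / 2 \<in> \<int>"
    and odd: "odd (a + b1 + b2 + b3)"
    and norm: "(\<Sum>i<6. y1 i ^ 2) + (\<Sum>i<6. y2 i ^ 2) + (\<Sum>i<6. y3 i ^ 2)
      + 2 * t4 ^ 2 + 2 * t5 ^ 2 + 2 * t6 ^ 2 = 5 / 2"
    and S: "S \<subseteq> {..<6}" "card S = 3"
    and large: "3 / 2 \<le> (\<Sum>i<6. half_split S i * y1 i) + t4"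
  shows "(\<forall>i<6. y1 i = half_split S i \<and> y2 i = 0 \<and> y3 i = 0) \<and> t4 = 0
    \<and> t5 ^ 2 = 1 / 4 \<and> t6 ^ 2 = 1 / 4"
proof -
  define N1 N2 N3 where N: "N1 = (\<Sum>i<6. y1 i ^ 2)" "N2 = (\<Sum>i<6. y2 i ^ 2)" "N3 = (\<Sum>i<6. y3 i ^ 2)"
  define s where "s = (\<Sum>i<6. half_split S i * y1 i)"
  have pos: "0 \<le> N1" "0 \<le> N2" "0 \<le> N3" "0 \<le> t4 ^ 2" "0 \<le> t5 ^ 2" "0 \<le> t6 ^ 2"
    by (auto simp: N intro: sum_nonneg)
  have cs: "s ^ 2 \<le> 3 / 2 * N1"
    unfolding N by (rule half_split_cauchy_schwarz[OF S s_def])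
  have sum: "N1 + N2 + N3 + 2 * t4 ^ 2 + 2 * t5 ^ 2 + 2 * t6 ^ 2 = 5 / 2"
    using norm by (simp add: N)
  have s_ge: "c ^ 2 \<le> s ^ 2" if "0 \<le> c" "c \<le> 3 / 2 - t4" for c
    using that large by (intro power_mono) (auto simp: s_def)
  obtain n where "t4 - real_of_int (b2 + b3) / 2 = real_of_int n"
    using t4 by (auto elim: Ints_cases)
  \<comment> \<open>The integer \<open>k\<close> is \<open>2 * t4\<close>; its parity is the glue
    class of the fourth block. The bounds below exclude every value except 0.\<close>
  then obtain k where k: "t4 = real_of_int k / 2" "even (k - (b2 + b3))"
    by (intro that[of "2 * n + (b2 + b3)"]) (auto simp: field_simps)
  define r1 r2 r3 where r: "r1 = (a + 3 * b1) mod 6" "r2 = (a + 3 * b2) mod 6" "r3 = (a + 3 * b3) mod 6"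
  have rN: "real_of_int (r1 * (6 - r1)) / 6 \<le> N1" "real_of_int (r2 * (6 - r2)) / 6 \<le> N2"
    "real_of_int (r3 * (6 - r3)) / 6 \<le> N3"
    unfolding r N by (rule in_coset_6_norm_ge[OF y1] in_coset_6_norm_ge[OF y2] in_coset_6_norm_ge[OF y3])+
  have r6: "r1 \<in> {0, 1, 2, 3, 4, 5}" "r2 \<in> {0, 1, 2, 3, 4, 5}" "r3 \<in> {0, 1, 2, 3, 4, 5}"
    unfolding r by (simp_all, presburger+)
  have "k \<le> 2"
  proof (rule ccontr)
    assume "\<not> k \<le> 2"
    then have "(3 / 2) ^ 2 \<le> t4 ^ 2"
      using k(1) by (intro power_mono) auto
    then have "9 / 4 \<le> t4 ^ 2"
      by (simp add: power_divide)
    with sum pos show False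
      by linarith
  qed
  \<comment> \<open>A negative \<open>t4\<close> forces \<open>s \<ge> 2\<close>, hence
    \<open>N1 \<ge> 8 / 3\<close>, which exceeds 5/2.\<close>
  moreover have "0 \<le> k"
  proof (rule ccontr)
    assume "\<not> 0 \<le> k"
    then have "k \<le> -1"
      by simp
    then have "2 ^ 2 \<le> s ^ 2"
      using k(1) by (intro s_ge) auto
    then have "4 \<le> s ^ 2"
      by simp
    with sum pos cs show False
      by linarith
  qed
  \<comment> \<open>Here \<open>N1 \<le> 1 / 2\<close> is below 5/6, the least minimal norm of a
    nonzero class, so the first block is integral. Then \<open>s\<close> is a positive integer and
    Cauchy-Schwarz gives \<open>N1 \<ge> 2 / 3\<close>.\<close>
  moreover have "k \<noteq> 2"
  proof
    assume "k = 2"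
    then have "t4 = 1"
      using k(1) by simp
    then have "t4 ^ 2 = 1"
      by simp
    with sum pos have "N1 \<le> 1 / 2"
      by linarith
    with rN(1) r6(1) have "r1 = 0"
      by auto
    then obtain m where m: "a + 3 * b1 = 6 * m"
      unfolding r by (metis dvd_def mod_0_imp_dvd)
    have "s - 3 * (real_of_int (a + 3 * b1) / 6) \<in> \<int>"
      unfolding s_def by (rule half_split_sum_coset[OF y1 S])
    moreover have "3 * (real_of_int (a + 3 * b1) / 6) = real_of_int (3 * m)"
      unfolding m by simp
    ultimately have "s \<in> \<int>"
      by (metis Ints_add Ints_of_int diff_add_cancel)
    then obtain l where l: "s = real_of_int l"
      by (auto elim: Ints_cases)
    have "0 < s"
      using large \<open>t4 = 1\<close> by (simp add: s_def)
    then have "1 \<le> s"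
      using l by simp
    then have "1 ^ 2 \<le> s ^ 2"
      by (intro power_mono) auto
    with cs \<open>N1 \<le> 1 / 2\<close> show False
      by simp
  qed
  \<comment> \<open>The classes of the second and third block differ by 3 modulo 6, so their minimal
    norms add up to at least 3/2, more than the 4/3 left by \<open>s \<ge> 1\<close>.\<close>
  moreover have "k \<noteq> 1"
  proof
    assume k1: "k = 1"
    then have t4: "t4 = 1 / 2"
      using k(1) by simp
    then have "1 ^ 2 \<le> s ^ 2"
      by (intro s_ge) auto
    then have "1 \<le> s ^ 2"
      by simp
    moreover have "t4 ^ 2 = 1 / 4"
      by (simp add: t4 power_divide)
    ultimately have N23: "N2 + N3 \<le> 4 / 3"
      using cs sum pos by linarith
    have "odd (b2 + b3)"
      using k(2) k1 by simp
    then have "r3 = (r2 + 3) mod 6"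
      unfolding r by presburger
    with r6(2) rN(2,3) N23 show False
      by auto
  qed
  ultimately have "k = 0"
    by simp
  then have [simp]: "t4 = 0"
    using k(1) by simp
  have even: "even (b2 + b3)"
    using k(2) \<open>k = 0\<close> by simp
  have s32: "3 / 2 \<le> s"
    using large by (simp add: s_def)
  have "(3 / 2) ^ 2 \<le> s ^ 2"
    by (intro s_ge) auto
  then have N1: "3 / 2 \<le> N1"
    using cs by (simp add: power2_eq_square)
  moreover have "t4 ^ 2 = 0"
    by simp
  ultimately have N23: "N2 + N3 \<le> 1"
    using sum pos by linarith
  \<comment> \<open>Equal nonzero classes would need norm at least 5/3 in these two blocks, but at
    most 1 is left. With both classes zero, the parity condition makes the fifth and sixth block
    half-integral, each of norm at least 1/2.\<close>
  have "r3 = r2"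
    unfolding r using even by presburger
  with r6(2) rN(2,3) N23 have "r2 = 0"
    by auto
  then have odds: "odd (b1 + b3)" "odd (b1 + b2)"
    unfolding r using even odd by presburger+
  then have t56: "1 / 4 \<le> t5 ^ 2" "1 / 4 \<le> t6 ^ 2"
    using half_integer_square_ge t5 t6 by blast+
  then have eqs: "N1 = 3 / 2" "N2 = 0" "N3 = 0" "t5 ^ 2 = 1 / 4" "t6 ^ 2 = 1 / 4"
    using sum pos N1 by auto
  \<comment> \<open>Equality case of Cauchy-Schwarz: the squared distance between the first block
    and \<open>half_split S\<close> is at most zero.\<close>
  have "(\<Sum>i<6. (y1 i - half_split S i) ^ 2)
      = (\<Sum>i<6. y1 i ^ 2 - 2 * (half_split S i * y1 i) + half_split S i * half_split S i)"
    by (intro sum.cong) (auto simp: power2_eq_square algebra_simps)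
  also have "\<dots> = N1 - 2 * s + 3 / 2"
    unfolding N s_def sum_half_split_sq[OF S, symmetric]
    by (simp only: sum.distrib sum_subtractf sum_distrib_left)
  also have "\<dots> \<le> 0"
    using s32 eqs(1) by simp
  finally have "(\<Sum>i<6. (y1 i - half_split S i) ^ 2) = 0"
    by (intro antisym sum_nonneg) auto
  then have "\<forall>i<6. y1 i = half_split S i"
    by (subst (asm) sum_nonneg_eq_0_iff) auto
  moreover have "\<forall>i<6. y2 i = 0" "\<forall>i<6. y3 i = 0"
    using eqs(2,3) unfolding N by (auto simp: sum_nonneg_eq_0_iff)
  ultimately show ?thesis
    using eqs by simp
qed

section \<open>Glue classes of lattice vectors\<close>

lemma A_lattice_in_coset:
  assumes "v \<in> A_lattice n" "m = n + 1"
  shows "v \<in> carrier_vec m" "in_coset m 0 (\<lambda>i. v $ i)"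
  using assms by (auto simp: A_lattice_def in_coset_def)

lemma alpha_in_coset:
  "alpha 5 \<in> carrier_vec 6" "in_coset 6 (1 / 6) (\<lambda>i. alpha 5 $ i)"
  "alpha 1 \<in> carrier_vec 2" "in_coset 2 (1 / 2) (\<lambda>i. alpha 1 $ i)"
  by (auto simp: alpha_def in_coset_def lessThan_Suc eval_nat_numeral)

lemma in_coset_zero_vec: "in_coset m 0 (\<lambda>i. 0\<^sub>v m $ i)"
  by (rule in_coset_cong[OF in_coset_zero]) auto

lemma smult_alpha_in_coset:
  "3 \<cdot>\<^sub>v alpha 5 \<in> carrier_vec 6" "in_coset 6 (1 / 2) (\<lambda>i. (3 \<cdot>\<^sub>v alpha 5) $ i)"
  by (auto simp: alpha_def in_coset_def lessThan_Suc eval_nat_numeral)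

lemma blocks_index:
  assumes "v1 \<in> carrier_vec 6" "v2 \<in> carrier_vec 6" "v3 \<in> carrier_vec 6" "v4 \<in> carrier_vec 2"
    "v5 \<in> carrier_vec 2" "v6 \<in> carrier_vec 2" "v7 \<in> carrier_vec 2"
  shows "blocks v1 v2 v3 v4 v5 v6 v7 \<in> carrier_vec 26"
    "i < 6 \<Longrightarrow> blocks v1 v2 v3 v4 v5 v6 v7 $ i = v1 $ i"
    "i < 6 \<Longrightarrow> blocks v1 v2 v3 v4 v5 v6 v7 $ (6 + i) = v2 $ i"
    "i < 6 \<Longrightarrow> blocks v1 v2 v3 v4 v5 v6 v7 $ (12 + i) = v3 $ i"
    "i < 2 \<Longrightarrow> blocks v1 v2 v3 v4 v5 v6 v7 $ (18 + i) = v4 $ i"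
    "i < 2 \<Longrightarrow> blocks v1 v2 v3 v4 v5 v6 v7 $ (20 + i) = v5 $ i"
    "i < 2 \<Longrightarrow> blocks v1 v2 v3 v4 v5 v6 v7 $ (22 + i) = v6 $ i"
    "i < 2 \<Longrightarrow> blocks v1 v2 v3 v4 v5 v6 v7 $ (24 + i) = v7 $ i"
  using assms by (auto simp: blocks_def intro: carrier_vecI)

text \<open>Membership of \<open>u\<close> in the coset of
  \<open>a * beta0 + b1 * beta1 + b2 * beta2 + b3 * beta3\<close> modulo
  \<open>Lambda_lattice\<close>, written block by block. The coefficients stay unreduced integers,
  so that they simply add.\<close>

definition glue :: "real vec \<Rightarrow> int \<Rightarrow> int \<Rightarrow> int \<Rightarrow> int \<Rightarrow> bool" where
  "glue u a b1 b2 b3 \<longleftrightarrow> u \<in> carrier_vec 26 \<and>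
     in_coset 6 (real_of_int (a + 3 * b1) / 6) (\<lambda>i. u $ i) \<and>
     in_coset 6 (real_of_int (a + 3 * b2) / 6) (\<lambda>i. u $ (6 + i)) \<and>
     in_coset 6 (real_of_int (a + 3 * b3) / 6) (\<lambda>i. u $ (12 + i)) \<and>
     in_coset 2 (real_of_int (b2 + b3) / 2) (\<lambda>i. u $ (18 + i)) \<and>
     in_coset 2 (real_of_int (b1 + b3) / 2) (\<lambda>i. u $ (20 + i)) \<and>
     in_coset 2 (real_of_int (b1 + b2) / 2) (\<lambda>i. u $ (22 + i)) \<and>
     in_coset 2 (real_of_int (a + b1 + b2 + b3) / 2) (\<lambda>i. u $ (24 + i))"

text \<open>The classes \<open>c1\<close> to \<open>c7\<close> are separate variables so that they
  unify with the known coset facts first; only numerical identities then remain.\<close>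

lemma glue_blocks:
  assumes "v1 \<in> carrier_vec 6" "v2 \<in> carrier_vec 6" "v3 \<in> carrier_vec 6" "v4 \<in> carrier_vec 2"
    "v5 \<in> carrier_vec 2" "v6 \<in> carrier_vec 2" "v7 \<in> carrier_vec 2"
    "in_coset 6 c1 (\<lambda>i. v1 $ i)" "in_coset 6 c2 (\<lambda>i. v2 $ i)" "in_coset 6 c3 (\<lambda>i. v3 $ i)"
    "in_coset 2 c4 (\<lambda>i. v4 $ i)" "in_coset 2 c5 (\<lambda>i. v5 $ i)" "in_coset 2 c6 (\<lambda>i. v6 $ i)"
    "in_coset 2 c7 (\<lambda>i. v7 $ i)"
    "c1 = real_of_int (a + 3 * b1) / 6" "c2 = real_of_int (a + 3 * b2) / 6"
    "c3 = real_of_int (a + 3 * b3) / 6" "c4 = real_of_int (b2 + b3) / 2"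
    "c5 = real_of_int (b1 + b3) / 2" "c6 = real_of_int (b1 + b2) / 2"
    "c7 = real_of_int (a + b1 + b2 + b3) / 2"
  shows "glue (blocks v1 v2 v3 v4 v5 v6 v7) a b1 b2 b3"
  unfolding glue_def
  by (intro conjI blocks_index(1) assms(1-7) in_coset_cong[OF assms(8) assms(15)]
      in_coset_cong[OF assms(9) assms(16)] in_coset_cong[OF assms(10) assms(17)]
      in_coset_cong[OF assms(11) assms(18)] in_coset_cong[OF assms(12) assms(19)]
      in_coset_cong[OF assms(13) assms(20)] in_coset_cong[OF assms(14) assms(21)])
    (simp_all only: blocks_index[OF assms(1-7)])

lemma glue_add:
  assumes u: "glue u a b1 b2 b3" and v: "glue v a' b1' b2' b3'"
  shows "glue (u + v) (a + a') (b1 + b1') (b2 + b2') (b3 + b3')"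
proof -
  have dim: "u \<in> carrier_vec 26" "v \<in> carrier_vec 26"
    using u v by (auto simp: glue_def)
  have coset: "in_coset m (real_of_int l'' / q) (\<lambda>i. (u + v) $ (k + i))"
    if "in_coset m (real_of_int l / q) (\<lambda>i. u $ (k + i))"
      "in_coset m (real_of_int l' / q) (\<lambda>i. v $ (k + i))" "k + m \<le> 26" "l'' = l + l'" for m k l l' l'' q
    using dim that by (intro in_coset_cong[OF in_coset_add[OF that(1,2)]]) (auto simp: add_divide_distrib)
  show ?thesis
    by (insert u v, unfold glue_def, elim conjE, intro conjI)
      (rule add_carrier_vec[OF dim],
        (rule coset coset[where k = 0, unfolded add_0], assumption, assumption, simp, simp)+)
qed

lemma glue_uminus:
  assumes u: "glue u a b1 b2 b3"
  shows "glue (- u) (- a) (- b1) (- b2) (- b3)"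
proof -
  have dim: "u \<in> carrier_vec 26"
    using u by (auto simp: glue_def)
  have coset: "in_coset m (real_of_int l' / q) (\<lambda>i. (- u) $ (k + i))"
    if "in_coset m (real_of_int l / q) (\<lambda>i. u $ (k + i))" "k + m \<le> 26" "l' = - l" for m k l l' q
    using dim that by (intro in_coset_cong[OF in_coset_uminus[OF that(1)]]) auto
  show ?thesis
    by (insert u, unfold glue_def, elim conjE, intro conjI)
      (simp add: dim, (rule coset coset[where k = 0, unfolded add_0], assumption, simp, simp)+)
qed

text \<open>Every generator has glue coefficients, and these are additive and change sign under
  negation; induction over the generated group does the rest.\<close>

lemma L_lattice_glue:
  assumes "u \<in> L_lattice"
  obtains a b1 b2 b3 where "glue u a b1 b2 b3"
proof -
  have gen: "\<exists>a b1 b2 b3. glue h a b1 b2 b3" if "h \<in> Lambda_lattice \<union> {beta0, beta1, beta2, beta3}" for h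
    using that
  proof (elim UnE insertE emptyE)
    assume "h \<in> Lambda_lattice"
    then obtain v1 v2 v3 v4 v5 v6 v7 where h: "h = blocks v1 v2 v3 v4 v5 v6 v7"
      and v: "v1 \<in> A_lattice 5" "v2 \<in> A_lattice 5" "v3 \<in> A_lattice 5"
        "v4 \<in> A_lattice 1" "v5 \<in> A_lattice 1" "v6 \<in> A_lattice 1" "v7 \<in> A_lattice 1"
      unfolding Lambda_lattice_def by blast
    have "glue h 0 0 0 0"
      unfolding h by (rule glue_blocks; (rule A_lattice_in_coset, rule v)?) simp_all
    then show ?thesis
      by blast
  next
    assume "h = beta0"
    have "glue beta0 1 0 0 0"
      unfolding beta0_def
      by (rule glue_blocks; (rule zero_carrier_vec alpha_in_coset in_coset_zero_vec)?) simp_all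
    with \<open>h = beta0\<close> show ?thesis
      by blast
  next
    assume "h = beta1"
    have "glue beta1 0 1 0 0"
      unfolding beta1_def
      by (rule glue_blocks; (rule zero_carrier_vec alpha_in_coset smult_alpha_in_coset in_coset_zero_vec)?)
        simp_all
    with \<open>h = beta1\<close> show ?thesis
      by blast
  next
    assume "h = beta2"
    have "glue beta2 0 0 1 0"
      unfolding beta2_def
      by (rule glue_blocks; (rule zero_carrier_vec alpha_in_coset smult_alpha_in_coset in_coset_zero_vec)?)
        simp_all
    with \<open>h = beta2\<close> show ?thesis
      by blast
  next
    assume "h = beta3"
    have "glue beta3 0 0 0 1"
      unfolding beta3_def
      by (rule glue_blocks; (rule zero_carrier_vec alpha_in_coset smult_alpha_in_coset in_coset_zero_vec)?)
        simp_all
    with \<open>h = beta3\<close> show ?thesis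
      by blast
  qed
  interpret G: comm_group "monoid_vec TYPE(real) 26"
    by (rule comm_group_vec)
  have inv_eq: "inv\<^bsub>monoid_vec TYPE(real) 26\<^esub> h = - h" if "h \<in> carrier_vec 26" for h
    using that by (intro G.inv_equality) (auto simp: monoid_vec_simps)
  have "\<exists>a b1 b2 b3. glue u a b1 b2 b3"
    using assms unfolding L_lattice_def
  proof (induction rule: generate.induct)
    case one
    have "glue (0\<^sub>v 26) 0 0 0 0"
      unfolding glue_def by (auto simp: in_coset_def)
    then show ?case
      unfolding monoid_vec_simps by blast
  next
    case (incl h)
    then show ?case
      by (rule gen)
  next
    case (inv h)
    then obtain a b1 b2 b3 where h: "glue h a b1 b2 b3"
      using gen by blast
    then have "h \<in> carrier_vec 26"
      by (simp add: glue_def)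
    with glue_uminus[OF h] show ?case
      by (metis inv_eq)
  next
    case (eng h1 h2)
    then show ?case
      unfolding monoid_vec_simps using glue_add by blast
  qed
  with that show thesis
    by blast
qed

section \<open>The inner product in block coordinates\<close>

lemma sum_lessThan_add:
  fixes f :: "nat \<Rightarrow> 'a::comm_monoid_add"
  shows "(\<Sum>i<m + n. f i) = (\<Sum>i<m. f i) + (\<Sum>i<n. f (m + i))"
  by (induction n) (simp_all add: ac_simps)

lemma scalar_prod_26:
  fixes u v :: "real vec"
  assumes "v \<in> carrier_vec 26"
  shows "u \<bullet> v = (\<Sum>i<6. u $ i * v $ i) + (\<Sum>i<6. u $ (6 + i) * v $ (6 + i))
    + (\<Sum>i<6. u $ (12 + i) * v $ (12 + i))
    + u $ 18 * v $ 18 + u $ 19 * v $ 19 + u $ 20 * v $ 20 + u $ 21 * v $ 21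
    + u $ 22 * v $ 22 + u $ 23 * v $ 23 + u $ 24 * v $ 24 + u $ 25 * v $ 25"
proof -
  have "u \<bullet> v = (\<Sum>i<6 + (6 + (6 + 8)). u $ i * v $ i)"
    using assms by (simp add: scalar_prod_def atLeast0LessThan)
  then show ?thesis
    unfolding sum_lessThan_add by (simp add: eval_nat_numeral ac_simps)
qed

section \<open>Extending an affine equiangular set\<close>

definition extension_vec :: "nat set \<Rightarrow> real vec" where
  "extension_vec S = vec 26 (\<lambda>i. if i < 6 then half_split S i else if i = 18 then 1
     else if i = 24 then 1 / 2 else if i = 25 then - 1 / 2 else 0)"

lemma extension_vec_carrier: "extension_vec S \<in> carrier_vec 26"
  by (simp add: extension_vec_def)

lemma scalar_prod_extension_vec:
  "u \<bullet> extension_vec S = (\<Sum>i<6. half_split S i * u $ i) + u $ 18 + (u $ 24 - u $ 25) / 2"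
proof -
  have "(\<Sum>i<6. u $ i * extension_vec S $ i) = (\<Sum>i<6. half_split S i * u $ i)"
    by (intro sum.cong) (auto simp: extension_vec_def)
  moreover have "(\<Sum>i<6. u $ (6 + i) * extension_vec S $ (6 + i)) = 0"
    "(\<Sum>i<6. u $ (12 + i) * extension_vec S $ (12 + i)) = 0"
    by (auto intro!: sum.neutral simp: extension_vec_def)
  ultimately show ?thesis
    unfolding scalar_prod_26[OF extension_vec_carrier] by (simp add: extension_vec_def diff_divide_distrib)
qed

text \<open>The first, fourth and last block contribute 3/2, 1 and 1/2.\<close>

lemma scalar_prod_extension_vec_self:
  assumes "S \<subseteq> {..<6}" "card S = 3"
  shows "extension_vec S \<bullet> extension_vec S = 3"
proof -
  have "(\<Sum>i<6. half_split S i * extension_vec S $ i) = (\<Sum>i<6. half_split S i * half_split S i)"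
    by (intro sum.cong) (auto simp: extension_vec_def)
  then show ?thesis
    unfolding scalar_prod_extension_vec
    by (simp add: sum_half_split_sq[OF assms]) (simp add: extension_vec_def)
qed

lemma extension_vec_not_in_L: "extension_vec S \<notin> L_lattice"
proof
  assume "extension_vec S \<in> L_lattice"
  then obtain a b1 b2 b3 where "glue (extension_vec S) a b1 b2 b3"
    by (rule L_lattice_glue)
  then have "in_coset 2 (real_of_int (b2 + b3) / 2) (\<lambda>i. extension_vec S $ (18 + i))"
    by (simp add: glue_def)
  from in_coset_2(1)[OF this] show False
    by (simp add: extension_vec_def)
qed

lemma rho_index:
  "rho \<in> carrier_vec 26" "i < 24 \<Longrightarrow> rho $ i = 0" "rho $ 24 = 1" "rho $ 25 = -1"
proof -
  have carrier: "2 \<cdot>\<^sub>v alpha 1 \<in> carrier_vec 2"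
    by (rule smult_carrier_vec[THEN iffD2]) (rule alpha_in_coset)
  note index = blocks_index[OF zero_carrier_vec zero_carrier_vec zero_carrier_vec zero_carrier_vec
      zero_carrier_vec zero_carrier_vec carrier, folded rho_def]
  show "rho \<in> carrier_vec 26"
    by (rule index)
  show "rho $ 24 = 1" "rho $ 25 = -1"
    using index(8)[of 0] index(8)[of 1] by (simp_all add: alpha_def)
  show "rho $ i = 0" if "i < 24"
    using that by (auto simp: rho_def blocks_def)
qed

lemma scalar_prod_rho: "u \<bullet> rho = u $ 24 - u $ 25"
  unfolding scalar_prod_26[OF rho_index(1)] by (simp add: rho_index)

text \<open>The only shape in which a norm 3 vector \<open>u\<close> of the lattice with
  \<open>u \<bullet> rho = 1\<close> can have a product with \<open>extension_vec S\<close> outside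
  \<open>{0, 1}\<close>: the product is 2 for \<open>e = 1\<close> and -1 for
  \<open>e = -1\<close>.\<close>

definition blocking :: "nat set \<Rightarrow> real \<Rightarrow> real vec \<Rightarrow> bool" where
  "blocking S e u \<longleftrightarrow> e \<in> {1, -1} \<and> u \<in> carrier_vec 26 \<and>
     (\<forall>i<6. u $ i = e * half_split S i \<and> u $ (6 + i) = 0 \<and> u $ (12 + i) = 0) \<and>
     u $ 18 = 0 \<and> u $ 19 = 0 \<and> u $ 20 \<in> {1 / 2, - 1 / 2} \<and> u $ 21 = - u $ 20 \<and>
     u $ 22 \<in> {1 / 2, - 1 / 2} \<and> u $ 23 = - u $ 22 \<and> u $ 24 = 1 / 2 \<and> u $ 25 = - 1 / 2"

text \<open>The product with \<open>extension_vec S\<close> is an integer. If it is at least 2, the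
  norm analysis applies to \<open>u\<close>; if it is at most -1, it applies to the negated first
  six blocks.\<close>

lemma L_lattice_extension_or_blocking:
  assumes L: "u \<in> L_lattice" and rho: "u \<bullet> rho = 1" and norm: "u \<bullet> u = 3"
    and S: "S \<subseteq> {..<6}" "card S = 3"
  shows "u \<bullet> extension_vec S \<in> {0, 1} \<or> (\<exists>e. blocking S e u)"
proof -
  obtain a b1 b2 b3 where "glue u a b1 b2 b3"
    using L by (rule L_lattice_glue)
  then have u: "u \<in> carrier_vec 26"
    and y1: "in_coset 6 (real_of_int (a + 3 * b1) / 6) (\<lambda>i. u $ i)"
    and y2: "in_coset 6 (real_of_int (a + 3 * b2) / 6) (\<lambda>i. u $ (6 + i))"
    and y3: "in_coset 6 (real_of_int (a + 3 * b3) / 6) (\<lambda>i. u $ (12 + i))"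
    and y4: "in_coset 2 (real_of_int (b2 + b3) / 2) (\<lambda>i. u $ (18 + i))"
    and y5: "in_coset 2 (real_of_int (b1 + b3) / 2) (\<lambda>i. u $ (20 + i))"
    and y6: "in_coset 2 (real_of_int (b1 + b2) / 2) (\<lambda>i. u $ (22 + i))"
    and y7: "in_coset 2 (real_of_int (a + b1 + b2 + b3) / 2) (\<lambda>i. u $ (24 + i))"
    by (simp_all only: glue_def)
  have eq: "u $ 19 = - u $ 18" "u $ 21 = - u $ 20" "u $ 23 = - u $ 22" "u $ 25 = - u $ 24"
    using in_coset_2(1)[OF y4] in_coset_2(1)[OF y5] in_coset_2(1)[OF y6] in_coset_2(1)[OF y7]
    by simp_all
  have t4: "u $ 18 - real_of_int (b2 + b3) / 2 \<in> \<int>"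
    and t5: "u $ 20 - real_of_int (b1 + b3) / 2 \<in> \<int>"
    and t6: "u $ 22 - real_of_int (b1 + b2) / 2 \<in> \<int>"
    and t7: "u $ 24 - real_of_int (a + b1 + b2 + b3) / 2 \<in> \<int>"
    using in_coset_2(2)[OF y4] in_coset_2(2)[OF y5] in_coset_2(2)[OF y6] in_coset_2(2)[OF y7]
    by simp_all
  have u24: "u $ 24 = 1 / 2"
    using rho eq(4) by (simp add: scalar_prod_rho)
  have odd: "odd (a + b1 + b2 + b3)"
  proof -
    obtain n where "1 / 2 - real_of_int (a + b1 + b2 + b3) / 2 = real_of_int n"
      using t7 unfolding u24 by (auto elim: Ints_cases)
    then have "real_of_int (a + b1 + b2 + b3) = real_of_int (1 - 2 * n)"
      by (simp add: field_simps)
    then have "a + b1 + b2 + b3 = 1 - 2 * n"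
      by (simp only: of_int_eq_iff)
    then show ?thesis
      by simp
  qed
  have norm': "(\<Sum>i<6. (u $ i) ^ 2) + (\<Sum>i<6. (u $ (6 + i)) ^ 2) + (\<Sum>i<6. (u $ (12 + i)) ^ 2)
      + 2 * (u $ 18) ^ 2 + 2 * (u $ 20) ^ 2 + 2 * (u $ 22) ^ 2 = 5 / 2"
    using norm unfolding scalar_prod_26[OF u] by (simp add: eq u24 power2_eq_square)
  define q where "q = (\<Sum>i<6. half_split S i * u $ i) + u $ 18"
  have ext: "u \<bullet> extension_vec S = q + 1 / 2"
    by (simp add: scalar_prod_extension_vec q_def eq(4) u24)
  \<comment> \<open>Modulo 1, \<open>q\<close> is half of \<open>a + 3 * b1 + b2 + b3\<close>, which
    is odd because the last block has entry 1/2. So the product \<open>q + 1 / 2\<close> equals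
    \<open>n + 1\<close>.\<close>
  obtain n where n: "q = real_of_int n + 1 / 2"
  proof -
    obtain k where "(\<Sum>i<6. half_split S i * u $ i) - 3 * (real_of_int (a + 3 * b1) / 6) = real_of_int k"
      using half_split_sum_coset[OF y1 S] by (auto elim: Ints_cases)
    moreover obtain l where "u $ 18 - real_of_int (b2 + b3) / 2 = real_of_int l"
      using t4 by (auto elim: Ints_cases)
    moreover obtain m where "a + b1 + b2 + b3 = 2 * m + 1"
      using odd by (rule oddE)
    then have "real_of_int (a + 3 * b1) + real_of_int (b2 + b3) = real_of_int (2 * (m + b1) + 1)"
      by (simp only: of_int_add[symmetric] of_int_eq_iff) simp
    ultimately have "q = real_of_int (k + l + m + b1) + 1 / 2"
      by (simp add: q_def field_simps)
    then show thesis
      by (rule that)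
  qed
  have sq: "t \<in> {1 / 2, - 1 / 2}" if "t ^ 2 = 1 / 4" for t :: real
    using that power2_eq_iff[of t "1 / 2"] by (simp add: power_divide)
  consider "n = 0 \<or> n = -1" | "n \<ge> 1" | "n \<le> -2"
    by linarith
  then show ?thesis
  proof cases
    case 1
    then show ?thesis
      by (auto simp: ext n)
  next
    case 2
    then have "3 / 2 \<le> (\<Sum>i<6. half_split S i * u $ i) + u $ 18"
      unfolding q_def[symmetric] n by simp
    from glue_norm_large_product[OF y1 y2 y3 t4 t5 t6 odd norm' S this]
    have "blocking S 1 u"
      using sq eq u u24 by (simp add: blocking_def)
    then show ?thesis
      by blast
  next
    case 3
    \<comment> \<open>Negation turns \<open>q \<le> - 3 / 2\<close> into the hypothesis of the norm
      analysis and preserves norms, cosets up to sign, and parity.\<close>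
    have neg: "- t - real_of_int l / 2 \<in> \<int>" if "t - real_of_int k / 2 \<in> \<int>" "l = - k" for t k l
      using Ints_minus[OF that(1)] that(2) by simp
    have neg_coset: "in_coset m (real_of_int l / d) (\<lambda>i. - y i)"
      if "in_coset m (real_of_int k / d) y" "l = - k" for m k l d y
      using in_coset_uminus[OF that(1)] that(2) by simp
    have odd': "odd (- a + - b1 + - b2 + - b3)"
      using odd by presburger
    have "real_of_int n \<le> -2"
      using 3 by simp
    then have "3 / 2 \<le> (\<Sum>i<6. half_split S i * - u $ i) + - u $ 18"
      using n by (simp add: q_def sum_negf)
    then have "(\<forall>i<6. - u $ i = half_split S i \<and> - u $ (6 + i) = 0 \<and> - u $ (12 + i) = 0)
        \<and> - u $ 18 = 0 \<and> (- u $ 20) ^ 2 = 1 / 4 \<and> (- u $ 22) ^ 2 = 1 / 4"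
      using norm'
      by (intro glue_norm_large_product[where a = "- a" and ?b1.0 = "- b1" and ?b2.0 = "- b2"
            and ?b3.0 = "- b3"] neg_coset[OF y1] neg_coset[OF y2] neg_coset[OF y3] neg[OF t4] neg[OF t5]
            neg[OF t6] odd' S) simp_all
    then have "blocking S (- 1) u"
      using sq eq u u24 by (auto simp: blocking_def)
    then show ?thesis
      by blast
  qed
qed

text \<open>By \<open>signs\<close>, \<open>e\<close> times \<open>u\<close> and \<open>e'\<close>
  times \<open>v\<close> agree on the fifth and sixth block, which contribute \<open>e * e'\<close>
  together. The first block gives \<open>e * e' * (card (S \<inter> T) - 3 / 2)\<close> and the last
  block 1/2.\<close>

lemma blocking_scalar_prod:
  assumes u: "blocking S e u" and v: "blocking T e' v"
    and S: "S \<subseteq> {..<6}" "card S = 3" and T: "T \<subseteq> {..<6}" "card T = 3"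
    and signs: "e * u $ 20 = e' * v $ 20" "e * u $ 22 = e' * v $ 22"
  shows "u \<bullet> v = e * e' * (real (card (S \<inter> T)) - 1 / 2) + 1 / 2"
proof -
  have v26: "v \<in> carrier_vec 26"
    using v by (simp add: blocking_def)
  have one: "t * t = 1" if "t \<in> {1, -1}" for t :: real
    using that by auto
  have quarter: "t * t = 1 / 4" if "t \<in> {1 / 2, - 1 / 2}" for t :: real
    using that by (elim insertE emptyE; hypsubst; simp)
  have e: "e * e = 1" "e' * e' = 1" "u $ 20 * u $ 20 = 1 / 4" "u $ 22 * u $ 22 = 1 / 4"
    using u v by (simp_all only: blocking_def one quarter)
  have "v $ 20 = e' * (e' * v $ 20)" "v $ 22 = e' * (e' * v $ 22)"
    using e(2) by (simp_all flip: mult.assoc)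
  then have v20: "v $ 20 = e' * (e * u $ 20)" "v $ 22 = e' * (e * u $ 22)"
    unfolding signs by simp_all
  have "u $ 20 * v $ 20 = e * e' * (u $ 20 * u $ 20)" "u $ 22 * v $ 22 = e * e' * (u $ 22 * u $ 22)"
    unfolding v20 by (simp_all only: mult_ac)
  then have prods: "u $ 20 * v $ 20 = e * e' / 4" "u $ 22 * v $ 22 = e * e' / 4"
    unfolding e by simp_all
  have "(\<Sum>i<6. u $ i * v $ i) = e * e' * (real (card (S \<inter> T)) - 3 / 2)"
    unfolding sum_half_split_mult[OF S(1) T(1) S(2) T(2), symmetric] sum_distrib_left
    using u v by (intro sum.cong) (simp_all add: blocking_def)
  moreover have "(\<Sum>i<6. u $ (6 + i) * v $ (6 + i)) = 0" "(\<Sum>i<6. u $ (12 + i) * v $ (12 + i)) = 0"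
    using u by (simp_all add: blocking_def)
  moreover have "u $ 18 = 0" "u $ 19 = 0" "u $ 21 = - u $ 20" "u $ 23 = - u $ 22"
    "v $ 21 = - v $ 20" "v $ 23 = - v $ 22"
    using u v by (simp_all only: blocking_def)
  moreover have "u $ 24 * v $ 24 = 1 / 4" "u $ 25 * v $ 25 = 1 / 4"
  proof -
    have ends: "u $ 24 = 1 / 2" "v $ 24 = 1 / 2" "u $ 25 = - 1 / 2" "v $ 25 = - 1 / 2"
      using u v by (simp_all only: blocking_def)
    show "u $ 24 * v $ 24 = 1 / 4" "u $ 25 * v $ 25 = 1 / 4"
      unfolding ends by simp_all
  qed
  ultimately show ?thesis
    unfolding scalar_prod_26[OF v26] by (simp add: prods algebra_simps)
qed

text \<open>Each splitting of the six coordinates into two triples is given by its triple containing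
  0, that is, by an edge \<open>d\<close> of the complete graph on \<open>{1..<6}\<close>. If all
  were blocked, two edges with a common vertex would get the same colour, and their blocking vectors
  a forbidden inner product.\<close>

lemma exists_unblocked_split:
  assumes \<omega>: "affine_equiangular 26 rho \<omega>"
  shows "\<exists>S \<subseteq> {..<6}. card S = 3 \<and> (\<forall>u\<in>\<omega>. \<forall>e. \<not> blocking S e u)"
proof (rule ccontr)
  assume *: "\<not> ?thesis"
  define V where "V = {1..<6::nat}"
  have S: "insert 0 d \<subseteq> {..<6}" "card (insert 0 d) = 3" "0 \<notin> d" "finite d"
    if "d \<subseteq> V" "card d = 2" for d
  proof -
    show "insert 0 d \<subseteq> {..<6}" "0 \<notin> d"
      using that by (auto simp: V_def)
    show "finite d"
      using that(2) by (intro card_ge_0_finite) simp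
    with \<open>0 \<notin> d\<close> show "card (insert 0 d) = 3"
      using that by simp
  qed
  have "\<exists>u e. u \<in> \<omega> \<and> blocking (insert 0 d) e u" if "d \<subseteq> V" "card d = 2" for d
    using * S(1,2)[OF that] by blast
  then obtain u e where ue: "u d \<in> \<omega>" "blocking (insert 0 d) (e d) (u d)"
    if "d \<subseteq> V" "card d = 2" for d
    by metis
  \<comment> \<open>The colour is the sign pattern on the fifth and sixth block after scaling by
    \<open>e d\<close>, which turns the first block into \<open>half_split (insert 0 d)\<close>.
    There are four colours.\<close>
  define c where "c d = (e d * u d $ 20, e d * u d $ 22)" for d
  define C :: "(real \<times> real) set" where "C = {1 / 2, - 1 / 2} \<times> {1 / 2, - 1 / 2}"
  have sign: "e * t \<in> {1 / 2, - 1 / 2}" if "e \<in> {1, -1}" "t \<in> {1 / 2, - 1 / 2}" for e t :: real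
    using that by (elim insertE emptyE) simp_all
  have "c d \<in> C" if "d \<subseteq> V" "card d = 2" for d
    using ue(2)[OF that] unfolding c_def C_def blocking_def by (intro SigmaI sign) blast+
  then obtain d d' where d: "d \<subseteq> V" "card d = 2" and d': "d' \<subseteq> V" "card d' = 2"
    and "d \<noteq> d'" "c d = c d'" "d \<inter> d' \<noteq> {}"
    by (rule complete_graph_edge_colouring[of V 2 C c, rotated 4])
      (simp_all add: V_def C_def card_cartesian_product)
  have "card (d \<inter> d') = 1"
  proof -
    have "d \<inter> d' \<subset> d"
      using d d' \<open>d \<noteq> d'\<close> S(4) by (metis card_subset_eq inf.absorb_iff1 inf_le1 psubsetI)
    then have "card (d \<inter> d') < 2"
      using psubset_card_mono[OF S(4)[OF d]] d by simp
    moreover have "card (d \<inter> d') \<noteq> 0"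
      using \<open>d \<inter> d' \<noteq> {}\<close> S(4)[OF d] by simp
    ultimately show ?thesis
      by simp
  qed
  then have card: "card (insert 0 d \<inter> insert 0 d') = 2"
    using S(3,4)[OF d] by (simp add: Int_insert_left Int_insert_right)
  have prod: "u d \<bullet> u d' = e d * e d' * (3 / 2) + 1 / 2"
    using blocking_scalar_prod[OF ue(2)[OF d] ue(2)[OF d'] S(1,2)[OF d] S(1,2)[OF d']] \<open>c d = c d'\<close> card
    by (simp add: c_def)
  have "e d \<in> {1, -1}" "e d' \<in> {1, -1}"
    using ue(2)[OF d] ue(2)[OF d'] by (simp_all only: blocking_def)
  then have "u d \<bullet> u d' \<in> {2, -1}"
    unfolding prod by auto
  \<comment> \<open>The value 3 covers the case that both edges are blocked by the same
    vector.\<close>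
  moreover have "u d \<bullet> u d' \<in> {0, 1, 3}"
    using \<omega> ue(1)[OF d] ue(1)[OF d'] by (cases "u d = u d'") (auto simp: affine_equiangular_def)
  ultimately show False
    by auto
qed

theorem theorem8p1:
  fixes \<omega> :: "real vec set"
  assumes "maximum_affine_equiangular_in 26 rho L_lattice \<omega>"
  shows "\<not> strongly_maximal 26 rho \<omega>"
proof
  assume max: "strongly_maximal 26 rho \<omega>"
  have \<omega>: "affine_equiangular 26 rho \<omega>" "\<omega> \<subseteq> L_lattice"
    using assms by (auto simp: maximum_affine_equiangular_in_def)
  obtain S where S: "S \<subseteq> {..<6}" "card S = 3" "\<And>u e. u \<in> \<omega> \<Longrightarrow> \<not> blocking S e u"
    using exists_unblocked_split[OF \<omega>(1)] by metis
  let ?p = "extension_vec S"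
  have prod: "u \<bullet> ?p \<in> {0, 1}" "?p \<bullet> u \<in> {0, 1}" if "u \<in> \<omega>" for u
  proof -
    have u: "u \<in> carrier_vec 26" "u \<bullet> rho = 1" "u \<bullet> u = 3" "u \<in> L_lattice"
      using \<omega> that by (auto simp: affine_equiangular_def)
    then show "u \<bullet> ?p \<in> {0, 1}"
      using L_lattice_extension_or_blocking S that by blast
    then show "?p \<bullet> u \<in> {0, 1}"
      using comm_scalar_prod[OF u(1) extension_vec_carrier] by simp
  qed
  have "?p \<bullet> rho = 1"
    by (simp add: scalar_prod_rho) (simp add: extension_vec_def)
  then have "affine_equiangular 26 rho (insert ?p \<omega>)"
    using \<omega>(1) prod scalar_prod_extension_vec_self[OF S(1,2)] extension_vec_carrier
    by (auto simp: affine_equiangular_def)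
  \<comment> \<open>The inclusion is proper because \<open>?p\<close> lies outside the lattice
    containing \<open>\<omega>\<close>; the identity embedding suffices, as no extra dimension is
    required.\<close>
  moreover have "id ` \<omega> \<subset> insert ?p \<omega>"
    using \<omega>(2) extension_vec_not_in_L by auto
  moreover have "isometric_embedding 26 26 id"
    by (simp add: isometric_embedding_def)
  ultimately show False
    using max unfolding strongly_maximal_def by (metis id_apply order_refl)
qed

end
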